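(* Let $(\Xi,\Xi^\infty)$ and $(\Lambda,\Lambda^\infty)$ be countable approximate groups, and let $f:(\Xi,\Xi^\infty)\to(\Lambda,\Lambda^\infty)$ be a quasimorphism of approximate groups (not assumed to be symmetric or unital) with defect set $D(f)$. Then $$\operatorname{asdim}\Xi \;\leq\; \operatorname{asdim}\Lambda + \operatorname{asdim}\left(f^{-1}\left(f(e_\Xi)\,D(f)^{-1}D(f)\right)\right).$$
   Context: Notation: for subsets $A,B$ of a group, $AB=\{ab\mid a\in A,b\in B\}$, $A^{-1}=\{a^{-1}\mid a\in A\}$, $A^1=A$, $A^k=A^{k-1}A$ for $k\geq 2$, and $gA=\{ga\mid a\in A\}$. Approximate groups: a subset $\Lambda$ of a group $G$ is an approximate subgroup if $\Lambda=\Lambda^{-1}$, $e\in\Lambda$, and there is a finite set $F\subseteq G$ with $\Lambda^2\subseteq\Lambda F$. Its enveloping group is the subgroup $\Lambda^\infty=\bigcup_{k\geq 1}\Lambda^k$ of $G$, and the pair $(\Lambda,\Lambda^\infty)$ is called an approximate group. It is countable if $\Lambda$ is countable (then $\Lambda^\infty$ is countable too). The identity of $\Xi^\infty$ is denoted $e_\Xi$. Quasimorphisms: a function $f:G\to H$ between groups is a quasimorphism if its defect set $D(f)=\{f(y)^{-1}f(x)^{-1}f(xy)\mid x,y\in G\}$ is finite. A quasimorphism of approximate groups $f:(\Xi,\Xi^\infty)\to(\Lambda,\Lambda^\infty)$ is a function $f:\Xi^\infty\to\Lambda^\infty$ with $f(\Xi)\subseteq\Lambda$ which is a quasimorphism of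 groups $\Xi^\infty\to\Lambda^\infty$; $D(f)$ is the defect set of $f:\Xi^\infty\to\Lambda^\infty$. The set $f^{-1}(\cdot)$ denotes the preimage under $f:\Xi^\infty\to\Lambda^\infty$, so it is a subset of $\Xi^\infty$. ($f$ is symmetric if $f(x^{-1})=f(x)^{-1}$ for all $x$, unital if it maps identity to identity.) Asymptotic dimension of a metric space: for an integer $n\geq 0$, a metric space $(X,d)$ satisfies $\operatorname{asdim}X\leq n$ if for every $r>0$ there is a cover $\mathcal U=\bigcup_{i=1}^{n+1}\mathcal U_i$ of $X$ such that for each $i$ any two different $U,U'\in\mathcal U_i$ satisfy $d(U,U')\geq r$ (with $d(U,U')=\inf\{d(u,u')\mid u\in U,u'\in U'\}$), and there is $D>0$ with $\operatorname{diam}U\leq D$ for all $U\in\mathcal U$. $\operatorname{asdim}X$ is the smallest such $n$, or $\infty$ if there is none. Asymptotic dimension of subsets of countable groups: every countable group admits a left-invariant proper metric compatible with the discrete topology (proper: closed balls are compact, so here all balls are finite). If $(\Lambda,\Lambda^\infty)$ is a countable approximate group and $A\subseteq\Lambda^\infty$ (for instance $A=\Lambda$), then $\operatorname{asdim}A:=\operatorname{asdim}(A,d|_{A\times A})$ for any left-invariant proper metric $d$ on $\Lambda^\infty$; this does not depend on the choice of $d$. *)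

theory Defs
  imports
    "HOL-Algebra.Coset"
    "HOL-Analysis.Abstract_Metric_Spaces"
    "HOL-Library.Extended_Nat"
    "HOL-Library.Extended_Real"
    "HOL-Library.Countable_Set"
begin

section \<open>Approximate groups\<close>

text \<open>Products, left translates and inverses of subsets of a group are the constants
  \<^const>\<open>set_mult\<close>, \<^const>\<open>l_coset\<close> and \<^const>\<open>SET_INV\<close> of the library. The zeroth power is an
  auxiliary value that yields \<open>A\<^sup>1 = A\<close> and \<open>A\<^sup>k = A\<^sup>k\<^sup>-\<^sup>1 A\<close> for subsets of the carrier.\<close>

primrec set_pow :: "('a, 'm) monoid_scheme \<Rightarrow> 'a set \<Rightarrow> nat \<Rightarrow> 'a set" where
  "set_pow G A 0 = {\<one>\<^bsub>G\<^esub>}"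
| "set_pow G A (Suc k) = set_pow G A k <#>\<^bsub>G\<^esub> A"

lemma (in group) set_pow_1: "A \<subseteq> carrier G \<Longrightarrow> set_pow G A 1 = A"
  by (force simp: set_mult_def)

definition approximate_subgroup :: "('a, 'm) monoid_scheme \<Rightarrow> 'a set \<Rightarrow> bool" where
  "approximate_subgroup G A \<longleftrightarrow>
     group G \<and> A \<subseteq> carrier G \<and> set_inv\<^bsub>G\<^esub> A = A \<and> \<one>\<^bsub>G\<^esub> \<in> A \<and>
     (\<exists>F. finite F \<and> F \<subseteq> carrier G \<and> set_pow G A 2 \<subseteq> A <#>\<^bsub>G\<^esub> F)"

definition enveloping_set :: "('a, 'm) monoid_scheme \<Rightarrow> 'a set \<Rightarrow> 'a set" where
  "enveloping_set G A = (\<Union>k\<in>{1..}. set_pow G A k)"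

definition enveloping_group :: "('a, 'm) monoid_scheme \<Rightarrow> 'a set \<Rightarrow> ('a, 'm) monoid_scheme" where
  "enveloping_group G A = G\<lparr>carrier := enveloping_set G A\<rparr>"


section \<open>Quasimorphisms\<close>

definition defect_set ::
  "('a, 'm) monoid_scheme \<Rightarrow> ('b, 'n) monoid_scheme \<Rightarrow> ('a \<Rightarrow> 'b) \<Rightarrow> 'b set" where
  "defect_set G H f =
     {inv\<^bsub>H\<^esub> (f y) \<otimes>\<^bsub>H\<^esub> inv\<^bsub>H\<^esub> (f x) \<otimes>\<^bsub>H\<^esub> f (x \<otimes>\<^bsub>G\<^esub> y) | x y. x \<in> carrier G \<and> y \<in> carrier G}"

definition quasimorphism ::
  "('a, 'm) monoid_scheme \<Rightarrow> ('b, 'n) monoid_scheme \<Rightarrow> ('a \<Rightarrow> 'b) \<Rightarrow> bool" where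
  "quasimorphism G H f \<longleftrightarrow> f \<in> carrier G \<rightarrow> carrier H \<and> finite (defect_set G H f)"

text \<open>The subset \<open>A\<close> lives in the ambient group \<open>G\<close> and \<open>B\<close> in \<open>H\<close>; only the values of \<open>f\<close> on
  the enveloping group of \<open>A\<close> matter.\<close>

definition approx_quasimorphism ::
  "('a, 'm) monoid_scheme \<Rightarrow> 'a set \<Rightarrow> ('b, 'n) monoid_scheme \<Rightarrow> 'b set \<Rightarrow> ('a \<Rightarrow> 'b) \<Rightarrow> bool" where
  "approx_quasimorphism G A H B f \<longleftrightarrow>
     quasimorphism (enveloping_group G A) (enveloping_group H B) f \<and> f ` A \<subseteq> B"


section \<open>Asymptotic dimension of metric spaces\<close>

text \<open>Distances and diameters are taken in the extended reals, so that a distance to the empty set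
  is \<open>\<infinity>\<close> and an unbounded set has diameter \<open>\<infinity>\<close>.\<close>

definition set_distance :: "('a \<Rightarrow> 'a \<Rightarrow> real) \<Rightarrow> 'a set \<Rightarrow> 'a set \<Rightarrow> ereal" where
  "set_distance d U V = (INF u\<in>U. INF v\<in>V. ereal (d u v))"

definition set_diameter :: "('a \<Rightarrow> 'a \<Rightarrow> real) \<Rightarrow> 'a set \<Rightarrow> ereal" where
  "set_diameter d U = (SUP u\<in>U. SUP v\<in>U. ereal (d u v))"

text \<open>The \<open>n + 1\<close> families of a cover are indexed by \<open>0, \<dots>, n\<close>.\<close>

definition asdim_le :: "'a set \<Rightarrow> ('a \<Rightarrow> 'a \<Rightarrow> real) \<Rightarrow> nat \<Rightarrow> bool" where
  "asdim_le X d n \<longleftrightarrow>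
     (\<forall>r>0. \<exists>\<U> :: nat \<Rightarrow> 'a set set.
        (\<Union>i\<le>n. \<Union>(\<U> i)) = X \<and>
        (\<forall>i\<le>n. \<forall>U\<in>\<U> i. \<forall>V\<in>\<U> i. U \<noteq> V \<longrightarrow> ereal r \<le> set_distance d U V) \<and>
        (\<exists>D>0. \<forall>i\<le>n. \<forall>U\<in>\<U> i. set_diameter d U \<le> ereal D))"

text \<open>The infimum of the empty set in \<^typ>\<open>enat\<close> is \<open>\<infinity>\<close>.\<close>

definition asdim :: "'a set \<Rightarrow> ('a \<Rightarrow> 'a \<Rightarrow> real) \<Rightarrow> enat" where
  "asdim X d = (INF n\<in>{n. asdim_le X d n}. enat n)"


section \<open>Asymptotic dimension of subsets of countable groups\<close>

definition proper_left_invariant_metric ::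
  "('a, 'm) monoid_scheme \<Rightarrow> ('a \<Rightarrow> 'a \<Rightarrow> real) \<Rightarrow> bool" where
  "proper_left_invariant_metric G d \<longleftrightarrow>
     Metric_space (carrier G) d \<and>
     (\<forall>g\<in>carrier G. \<forall>x\<in>carrier G. \<forall>y\<in>carrier G. d (g \<otimes>\<^bsub>G\<^esub> x) (g \<otimes>\<^bsub>G\<^esub> y) = d x y) \<and>
     Metric_space.mtopology (carrier G) d = discrete_topology (carrier G) \<and>
     (\<forall>x\<in>carrier G. \<forall>r. compactin (Metric_space.mtopology (carrier G) d)
        (Metric_space.mcball (carrier G) d x r))"

text \<open>The choice of the metric is legitimate: such metrics exist on countable groups, and the value
  does not depend on the metric. Both facts are proved at the end of this theory.\<close>

definition group_asdim :: "('a, 'm) monoid_scheme \<Rightarrow> 'a set \<Rightarrow> enat" where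
  "group_asdim G A = asdim A (SOME d. proper_left_invariant_metric G d)"


section \<open>Well-definedness\<close>

lemma (in group) set_pow_subset: "A \<subseteq> carrier G \<Longrightarrow> set_pow G A k \<subseteq> carrier G"
  by (induction k) (auto simp: set_mult_def)

lemma (in group) set_pow_add:
  assumes "A \<subseteq> carrier G"
  shows "set_pow G A (j + k) = set_pow G A j <#> set_pow G A k"
proof (induction k)
  case 0
  have "set_pow G A j <#> {\<one>} = set_pow G A j"
    using set_pow_subset[OF assms, of j] by (force simp: set_mult_def)
  then show ?case by simp
next
  case (Suc k)
  then show ?case using assms by (simp add: set_mult_assoc set_pow_subset)
qed

lemma (in group) set_pow_inv:
  assumes A: "A \<subseteq> carrier G" "set_inv A = A" and x: "x \<in> set_pow G A k"
  shows "inv x \<in> set_pow G A k"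
  using x
proof (induction k arbitrary: x)
  case 0
  then show ?case by simp
next
  case (Suc k)
  then obtain y a where ya: "y \<in> set_pow G A k" "a \<in> A" "x = y \<otimes> a"
    by (auto simp: set_mult_def)
  have "inv a \<in> A" using ya A unfolding SET_INV_def by blast
  then have "inv a \<in> set_pow G A 1" using set_pow_1[OF A(1)] by simp
  moreover have "inv x = inv a \<otimes> inv y"
    using ya A set_pow_subset[OF A(1)] by (auto simp: inv_mult_group subset_iff)
  ultimately have "inv x \<in> set_pow G A 1 <#> set_pow G A k"
    using Suc.IH[OF ya(1)] unfolding set_mult_def by blast
  then show ?case
    using set_pow_add[OF A(1), of 1 k] by simp
qed

lemma subgroup_enveloping_set:
  assumes "approximate_subgroup G A"
  shows "subgroup (enveloping_set G A) G"
proof -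
  interpret group G using assms by (simp add: approximate_subgroup_def)
  have A: "A \<subseteq> carrier G" "set_inv\<^bsub>G\<^esub> A = A" "\<one>\<^bsub>G\<^esub> \<in> A"
    using assms by (auto simp: approximate_subgroup_def)
  have sub: "enveloping_set G A \<subseteq> carrier G"
    using set_pow_subset[OF A(1)] by (auto simp: enveloping_set_def)
  show ?thesis
  proof
    show "enveloping_set G A \<subseteq> carrier G" by (rule sub)
    show "\<one>\<^bsub>G\<^esub> \<in> enveloping_set G A"
      using A set_pow_1[OF A(1)] unfolding enveloping_set_def by (metis UN_I atLeast_iff order_refl)
    show "x \<otimes>\<^bsub>G\<^esub> y \<in> enveloping_set G A"
      if xy: "x \<in> enveloping_set G A" "y \<in> enveloping_set G A" for x y
    proof -
      obtain j k where "j \<ge> 1" "x \<in> set_pow G A j" "y \<in> set_pow G A k"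
        using xy unfolding enveloping_set_def by auto
      then have "j + k \<ge> 1" "x \<otimes>\<^bsub>G\<^esub> y \<in> set_pow G A (j + k)"
        unfolding set_pow_add[OF A(1)] set_mult_def by auto
      then show ?thesis unfolding enveloping_set_def by blast
    qed
    show "inv\<^bsub>G\<^esub> x \<in> enveloping_set G A" if "x \<in> enveloping_set G A" for x
      using that set_pow_inv[OF A(1,2)] unfolding enveloping_set_def by blast
  qed
qed

lemma group_enveloping_group:
  "approximate_subgroup G A \<Longrightarrow> group (enveloping_group G A)"
  using subgroup.subgroup_is_group[OF subgroup_enveloping_set]
  by (auto simp: enveloping_group_def approximate_subgroup_def)

lemma subset_enveloping_group:
  assumes "approximate_subgroup G A"
  shows "A \<subseteq> carrier (enveloping_group G A)"
proof -
  interpret group G using assms by (simp add: approximate_subgroup_def)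
  have "A \<subseteq> carrier G" using assms by (simp add: approximate_subgroup_def)
  then have "A = set_pow G A 1" by (simp only: set_pow_1)
  also have "\<dots> \<subseteq> carrier (enveloping_group G A)"
    unfolding enveloping_group_def enveloping_set_def by auto
  finally show ?thesis .
qed

lemma countable_enveloping_group:
  assumes "countable A"
  shows "countable (carrier (enveloping_group G A))"
proof -
  have "countable (set_pow G A k)" for k
    by (induction k) (use assms in \<open>auto simp: set_mult_def\<close>)
  then show ?thesis by (simp add: enveloping_group_def enveloping_set_def)
qed

lemma proper_left_invariant_metric_finite:
  assumes "proper_left_invariant_metric G d" "x \<in> carrier G"
  shows "finite {y \<in> carrier G. d x y \<le> r}"
proof -
  interpret Metric_space "carrier G" d
    using assms by (simp add: proper_left_invariant_metric_def)
  have "finite (mcball x r)"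
    using assms by (auto simp: proper_left_invariant_metric_def compactin_discrete_topology)
  moreover have "mcball x r = {y \<in> carrier G. d x y \<le> r}"
    using assms by (auto simp: mcball_def)
  ultimately show ?thesis by simp
qed

lemma ex_proper_left_invariant_metric:
  assumes "group G" "countable (carrier G)"
  shows "\<exists>d. proper_left_invariant_metric G d"
proof -
  interpret group G by fact
  have cancel: "x \<otimes>\<^bsub>G\<^esub> (inv\<^bsub>G\<^esub> x \<otimes>\<^bsub>G\<^esub> y) = y" "inv\<^bsub>G\<^esub> x \<otimes>\<^bsub>G\<^esub> (x \<otimes>\<^bsub>G\<^esub> y) = y"
    if "x \<in> carrier G" "y \<in> carrier G" for x y
    using that by (simp_all flip: m_assoc)
  define e where "e = from_nat_into (carrier G)"
  have e: "e n \<in> carrier G" for n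
    unfolding e_def by (rule from_nat_into) blast
  define B where
    "B = rec_nat {\<one>\<^bsub>G\<^esub>} (\<lambda>n S. (S <#>\<^bsub>G\<^esub> S) \<union> {e n, inv\<^bsub>G\<^esub> (e n)})"
  have B0: "B 0 = {\<one>\<^bsub>G\<^esub>}" and BS: "B (Suc n) = (B n <#>\<^bsub>G\<^esub> B n) \<union> {e n, inv\<^bsub>G\<^esub> (e n)}" for n
    by (simp_all add: B_def)
  have fin: "finite (B n)" for n
    by (induction n) (auto simp: B0 BS set_mult_def)
  have sub: "B n \<subseteq> carrier G" for n
    by (induction n) (use e in \<open>auto simp: B0 BS set_mult_def\<close>)
  have one: "\<one>\<^bsub>G\<^esub> \<in> B n" for n
    by (induction n) (force simp: B0 BS set_mult_def)+
  have minv: "inv\<^bsub>G\<^esub> x \<in> B n" if "x \<in> B n" for x n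
    using that
  proof (induction n arbitrary: x)
    case 0
    then show ?case by (simp add: B0)
  next
    case (Suc n)
    consider "x = e n \<or> x = inv\<^bsub>G\<^esub> (e n)" | y z where "y \<in> B n" "z \<in> B n" "x = y \<otimes>\<^bsub>G\<^esub> z"
      using Suc.prems by (auto simp: BS set_mult_def)
    then show ?case
    proof cases
      case 1
      then show ?thesis using e by (auto simp: BS)
    next
      case 2
      then have "inv\<^bsub>G\<^esub> x = inv\<^bsub>G\<^esub> z \<otimes>\<^bsub>G\<^esub> inv\<^bsub>G\<^esub> y"
        using sub by (simp add: inv_mult_group subset_iff)
      then show ?thesis using 2 Suc.IH unfolding BS set_mult_def by blast
    qed
  qed
  have step: "B n \<subseteq> B (Suc n)" for n
  proof
    fix x assume x: "x \<in> B n"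
    then have "x = x \<otimes>\<^bsub>G\<^esub> \<one>\<^bsub>G\<^esub>" using sub by (simp add: subset_iff)
    then show "x \<in> B (Suc n)" using x one unfolding BS set_mult_def by blast
  qed
  have mono: "B m \<subseteq> B n" if "m \<le> n" for m n
    using lift_Suc_mono_le[of B, OF step that] .
  have cover: "\<exists>n. x \<in> B n" if x: "x \<in> carrier G" for x
  proof -
    obtain n where "e n = x"
      using from_nat_into_surj[OF assms(2) x] unfolding e_def by blast
    then show ?thesis using BS by blast
  qed
  define L where "L x = (LEAST n. x \<in> B n)" for x
  have L_in: "x \<in> B (L x)" if "x \<in> carrier G" for x
    unfolding L_def using LeastI_ex[OF cover[OF that]] .
  have L_le: "L x \<le> n" if "x \<in> B n" for x n
    unfolding L_def using that by (rule Least_le)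
  have L0: "L x = 0 \<longleftrightarrow> x = \<one>\<^bsub>G\<^esub>" if "x \<in> carrier G" for x
  proof
    assume "L x = 0"
    then show "x = \<one>\<^bsub>G\<^esub>" using L_in[OF that] B0 by simp
  next
    assume "x = \<one>\<^bsub>G\<^esub>"
    then have "x \<in> B 0" by (simp add: B0)
    then show "L x = 0" using L_le by blast
  qed
  have L_inv: "L (inv\<^bsub>G\<^esub> x) = L x" if x: "x \<in> carrier G" for x
  proof (rule antisym)
    show "L (inv\<^bsub>G\<^esub> x) \<le> L x" by (intro L_le minv L_in x)
    have "inv\<^bsub>G\<^esub> (inv\<^bsub>G\<^esub> x) \<in> B (L (inv\<^bsub>G\<^esub> x))" by (intro minv L_in inv_closed x)
    then show "L x \<le> L (inv\<^bsub>G\<^esub> x)" using x by (intro L_le) simp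
  qed
  have L_mult: "L (x \<otimes>\<^bsub>G\<^esub> y) \<le> L x + L y" if x: "x \<in> carrier G" and y: "y \<in> carrier G" for x y
  proof (cases "x = \<one>\<^bsub>G\<^esub> \<or> y = \<one>\<^bsub>G\<^esub>")
    case True
    then show ?thesis using x y by auto
  next
    case False
    then have pos: "L x > 0" "L y > 0" using L0 x y by auto
    have "x \<in> B (max (L x) (L y))" "y \<in> B (max (L x) (L y))"
      using L_in x y mono by (meson max.cobounded1 max.cobounded2 subsetD)+
    then have "x \<otimes>\<^bsub>G\<^esub> y \<in> B (Suc (max (L x) (L y)))"
      unfolding BS set_mult_def by blast
    from L_le[OF this] show ?thesis using pos by linarith
  qed
  define d where "d x y = (if x \<in> carrier G \<and> y \<in> carrier G
      then real (L (inv\<^bsub>G\<^esub> x \<otimes>\<^bsub>G\<^esub> y)) else 0)" for x y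
  have met: "Metric_space (carrier G) d"
  proof
    show "0 \<le> d x y" for x y by (simp add: d_def)
    show "d x y = d y x" for x y
    proof (cases "x \<in> carrier G \<and> y \<in> carrier G")
      case True
      then have "inv\<^bsub>G\<^esub> (inv\<^bsub>G\<^esub> x \<otimes>\<^bsub>G\<^esub> y) = inv\<^bsub>G\<^esub> y \<otimes>\<^bsub>G\<^esub> x"
        by (simp add: inv_mult_group)
      then show ?thesis using L_inv[of "inv\<^bsub>G\<^esub> x \<otimes>\<^bsub>G\<^esub> y"] True by (simp add: d_def)
    qed (auto simp: d_def)
    show "d x y = 0 \<longleftrightarrow> x = y" if x: "x \<in> carrier G" and y: "y \<in> carrier G" for x y
    proof -
      have "d x y = 0 \<longleftrightarrow> inv\<^bsub>G\<^esub> x \<otimes>\<^bsub>G\<^esub> y = \<one>\<^bsub>G\<^esub>"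
        using L0[OF m_closed[OF inv_closed[OF x] y]] x y by (simp add: d_def)
      also have "\<dots> \<longleftrightarrow> x = y"
        using cancel(1)[OF x y] x y by fastforce
      finally show ?thesis .
    qed
    show "d x z \<le> d x y + d y z"
      if "x \<in> carrier G" "y \<in> carrier G" "z \<in> carrier G" for x y z
    proof -
      have "(inv\<^bsub>G\<^esub> x \<otimes>\<^bsub>G\<^esub> y) \<otimes>\<^bsub>G\<^esub> (inv\<^bsub>G\<^esub> y \<otimes>\<^bsub>G\<^esub> z) = inv\<^bsub>G\<^esub> x \<otimes>\<^bsub>G\<^esub> z"
        using that by (simp add: m_assoc cancel)
      then show ?thesis
        using L_mult[of "inv\<^bsub>G\<^esub> x \<otimes>\<^bsub>G\<^esub> y" "inv\<^bsub>G\<^esub> y \<otimes>\<^bsub>G\<^esub> z"] that by (simp add: d_def)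
    qed
  qed
  interpret M: Metric_space "carrier G" d by (rule met)
  have inv: "d (g \<otimes>\<^bsub>G\<^esub> x) (g \<otimes>\<^bsub>G\<^esub> y) = d x y"
    if "g \<in> carrier G" "x \<in> carrier G" "y \<in> carrier G" for g x y
  proof -
    have "inv\<^bsub>G\<^esub> (g \<otimes>\<^bsub>G\<^esub> x) \<otimes>\<^bsub>G\<^esub> (g \<otimes>\<^bsub>G\<^esub> y) = inv\<^bsub>G\<^esub> x \<otimes>\<^bsub>G\<^esub> y"
      using that by (simp add: inv_mult_group m_assoc cancel)
    then show ?thesis using that by (simp add: d_def)
  qed
  have top: "M.mtopology = discrete_topology (carrier G)"
  proof (rule sym, subst discrete_topology_unique, intro conjI ballI)
    show "topspace M.mtopology = carrier G" by simp
    fix x assume x: "x \<in> carrier G"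
    have "y = x" if "y \<in> carrier G" "d x y < 1" for y
    proof -
      have "L (inv\<^bsub>G\<^esub> x \<otimes>\<^bsub>G\<^esub> y) = 0" using that x by (simp add: d_def)
      then have "d x y = 0" using that x by (simp add: d_def)
      then show ?thesis using M.zero[OF x that(1)] by simp
    qed
    then have "M.mball x 1 = {x}" using x by auto
    then show "openin M.mtopology {x}" by (metis M.openin_mball)
  qed
  have "compactin M.mtopology (M.mcball x r)" if x: "x \<in> carrier G" for x r
  proof -
    have "M.mcball x r \<subseteq> (\<lambda>z. x \<otimes>\<^bsub>G\<^esub> z) ` B (nat \<lfloor>r\<rfloor>)"
    proof
      fix y assume "y \<in> M.mcball x r"
      then have y: "y \<in> carrier G" "real (L (inv\<^bsub>G\<^esub> x \<otimes>\<^bsub>G\<^esub> y)) \<le> r"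
        using x by (auto simp: M.mcball_def d_def)
      then have "L (inv\<^bsub>G\<^esub> x \<otimes>\<^bsub>G\<^esub> y) \<le> nat \<lfloor>r\<rfloor>" by (simp add: le_nat_floor)
      then have "inv\<^bsub>G\<^esub> x \<otimes>\<^bsub>G\<^esub> y \<in> B (nat \<lfloor>r\<rfloor>)"
        using L_in[of "inv\<^bsub>G\<^esub> x \<otimes>\<^bsub>G\<^esub> y"] x y mono by blast
      moreover have "y = x \<otimes>\<^bsub>G\<^esub> (inv\<^bsub>G\<^esub> x \<otimes>\<^bsub>G\<^esub> y)"
        using x y by (simp add: cancel)
      ultimately show "y \<in> (\<lambda>z. x \<otimes>\<^bsub>G\<^esub> z) ` B (nat \<lfloor>r\<rfloor>)" by blast
    qed
    then have "finite (M.mcball x r)" using fin finite_subset by blast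
    then show ?thesis
      by (simp add: top compactin_discrete_topology M.mcball_subset_mspace)
  qed
  then have "proper_left_invariant_metric G d"
    unfolding proper_left_invariant_metric_def using met inv top by auto
  then show ?thesis by blast
qed

lemma proper_left_invariant_metric_control:
  assumes G: "group G"
    and d: "proper_left_invariant_metric G d" and d': "proper_left_invariant_metric G d'"
  shows "\<exists>s. \<forall>x\<in>carrier G. \<forall>y\<in>carrier G. d x y \<le> r \<longrightarrow> d' x y \<le> s"
proof -
  interpret group G by fact
  define S where "S = {y \<in> carrier G. d \<one>\<^bsub>G\<^esub> y \<le> r}"
  have "finite S" unfolding S_def by (rule proper_left_invariant_metric_finite[OF d one_closed])
  then have "bdd_above (d' \<one>\<^bsub>G\<^esub> ` S)" by simp
  then obtain s where s: "\<And>y. y \<in> S \<Longrightarrow> d' \<one>\<^bsub>G\<^esub> y \<le> s"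
    unfolding bdd_above_def by blast
  have shift: "d x y = d \<one>\<^bsub>G\<^esub> (inv\<^bsub>G\<^esub> x \<otimes>\<^bsub>G\<^esub> y)" "d' x y = d' \<one>\<^bsub>G\<^esub> (inv\<^bsub>G\<^esub> x \<otimes>\<^bsub>G\<^esub> y)"
    if "x \<in> carrier G" "y \<in> carrier G" for x y
    using d d' that unfolding proper_left_invariant_metric_def by (metis inv_closed l_inv)+
  show ?thesis
  proof (intro exI[of _ s] ballI impI)
    fix x y assume xy: "x \<in> carrier G" "y \<in> carrier G" "d x y \<le> r"
    then have "d \<one>\<^bsub>G\<^esub> (inv\<^bsub>G\<^esub> x \<otimes>\<^bsub>G\<^esub> y) \<le> r" using shift(1)[OF xy(1,2)] by simp
    then have "inv\<^bsub>G\<^esub> x \<otimes>\<^bsub>G\<^esub> y \<in> S" unfolding S_def using xy(1,2) by blast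
    then show "d' x y \<le> s" using s shift(2)[OF xy(1,2)] by simp
  qed
qed

lemma asdim_le_transfer:
  assumes G: "group G" and A: "A \<subseteq> carrier G"
    and d: "proper_left_invariant_metric G d" and d': "proper_left_invariant_metric G d'"
    and le: "asdim_le A d n"
  shows "asdim_le A d' n"
  unfolding asdim_le_def
proof (intro allI impI)
  fix r :: real assume "r > 0"
  obtain s where s: "\<And>x y. x \<in> carrier G \<Longrightarrow> y \<in> carrier G \<Longrightarrow> d' x y \<le> r \<Longrightarrow> d x y \<le> s"
    using proper_left_invariant_metric_control[OF G d' d] by blast
  define t where "t = max s 0 + 1"
  have "t > 0" by (simp add: t_def)
  then obtain \<U> D where cov: "(\<Union>i\<le>n. \<Union>(\<U> i)) = A"
    and far: "\<And>i U V. i \<le> n \<Longrightarrow> U \<in> \<U> i \<Longrightarrow> V \<in> \<U> i \<Longrightarrow> U \<noteq> V \<Longrightarrow> ereal t \<le> set_distance d U V"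
    and bnd: "\<And>i U. i \<le> n \<Longrightarrow> U \<in> \<U> i \<Longrightarrow> set_diameter d U \<le> ereal D"
    using le unfolding asdim_le_def by metis
  obtain E where E: "\<And>x y. x \<in> carrier G \<Longrightarrow> y \<in> carrier G \<Longrightarrow> d x y \<le> D \<Longrightarrow> d' x y \<le> E"
    using proper_left_invariant_metric_control[OF G d d'] by blast
  have car: "u \<in> carrier G" if "u \<in> U" "U \<in> \<U> i" "i \<le> n" for u U i
    using that cov A by blast
  show "\<exists>\<U>. (\<Union>i\<le>n. \<Union>(\<U> i)) = A \<and>
        (\<forall>i\<le>n. \<forall>U\<in>\<U> i. \<forall>V\<in>\<U> i. U \<noteq> V \<longrightarrow> ereal r \<le> set_distance d' U V) \<and>
        (\<exists>D>0. \<forall>i\<le>n. \<forall>U\<in>\<U> i. set_diameter d' U \<le> ereal D)"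
  proof (intro exI[of _ \<U>] conjI allI impI ballI exI[of _ "max E 1"])
    show "(\<Union>i\<le>n. \<Union>(\<U> i)) = A" by (rule cov)
    show "0 < max E 1" by simp
    show "ereal r \<le> set_distance d' U V"
      if i: "i \<le> n" and UV: "U \<in> \<U> i" "V \<in> \<U> i" "U \<noteq> V" for i U V
      unfolding set_distance_def
    proof (intro INF_greatest)
      fix u v assume uv: "u \<in> U" "v \<in> V"
      have "t \<le> d u v"
        using far[OF i UV] uv by (simp add: set_distance_def le_INF_iff)
      then show "ereal r \<le> ereal (d' u v)"
        using s[of u v] car[OF uv(1) UV(1) i] car[OF uv(2) UV(2) i] by (fastforce simp: t_def)
    qed
    show "set_diameter d' U \<le> ereal (max E 1)" if i: "i \<le> n" and U: "U \<in> \<U> i" for i U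
      unfolding set_diameter_def
    proof (intro SUP_least)
      fix u v assume uv: "u \<in> U" "v \<in> U"
      have "d u v \<le> D" using bnd[OF i U] uv by (simp add: set_diameter_def SUP_le_iff)
      then have "d' u v \<le> max E 1"
        using E[of u v] car[OF uv(1) U i] car[OF uv(2) U i] by simp
      then show "ereal (d' u v) \<le> ereal (max E 1)" by (simp only: ereal_less_eq)
    qed
  qed
qed

theorem group_asdim_eq:
  assumes "group G" "A \<subseteq> carrier G" "proper_left_invariant_metric G d"
  shows "group_asdim G A = asdim A d"
proof -
  let ?d = "SOME d. proper_left_invariant_metric G d"
  have "proper_left_invariant_metric G ?d" using assms(3) by (rule someI[where P = "proper_left_invariant_metric G"])
  then have "asdim_le A ?d n \<longleftrightarrow> asdim_le A d n" for n
    using asdim_le_transfer assms by metis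
  then show ?thesis by (simp add: group_asdim_def asdim_def)
qed

end

theory Submission
  imports Defs
begin

text \<open>The theorem is a Hurewicz-type inequality: the dimension of the source is at most the dimension of
the target plus the dimension of the fibres. Two facts make it available here. A quasimorphism
moves points at bounded distance to points at bounded distance
(\<open>quasimorphism_bornologous\<close>). And if \<open>f x = f x'\<close>, then \<open>f (x\<inverse> x')\<close> and
\<open>f e = f (x\<inverse> x)\<close> are both obtained from the same element \<open>f (x\<inverse>) f x\<close> by
multiplying with a defect on the right, so that \<open>x\<inverse> x'\<close> lies in
\<open>K = f\<inverse> (f(e) D\<inverse> D)\<close> (\<open>quasimorphism_fibre\<close>). Every fibre of \<open>f\<close> is thus contained
in a left translate of the one set \<open>K\<close>, and as left translations are isometries, all fibres have
dimension at most \<open>asdim K\<close> with bounds that do not depend on the fibre.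

The Hurewicz inequality itself is \<open>asdim_le_hurewicz\<close>. Let \<open>asdim B \<le> n\<close> for the target \<open>B\<close>, and
let the fibres have dimension at most \<open>m\<close>, uniformly. The target is covered by \<open>n + m + 1\<close>
families of far apart bounded sets in such a way that each point lies in at least \<open>m + 1\<close> of them
(\<open>kolmogorov_trick\<close>). The fibre over \<open>y\<close> is covered by \<open>m + 1\<close> families, and these are given as
labels \<open>m + 1\<close> of the families whose union contains \<open>y\<close>. The \<open>i\<close>-th family of the source consists
of all pieces of fibres that are labelled \<open>i\<close>. They lie over the \<open>i\<close>-th family of the target, so
only the pieces over one bounded set \<open>V\<close> can come close to each other. As \<open>B\<close> sits in a group with
a proper left-invariant metric, the number of points of such \<open>V\<close> is bounded. Its points receive distinct
colours from a finite palette (\<open>greedy_colouring\<close>), and the fibres over the points of colour \<open>t\<close>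
are cut at a scale much larger than the size of what the smaller colours contribute. At most
one fibre over \<open>V\<close> has a given colour, so the union over the colours is taken one fibre at a
time, and each step preserves boundedness (\<open>comp_bounded_Un\<close>). The uniform bound
on the number of points of \<open>V\<close> makes finitely many scales suffice.\<close>

section \<open>Chains and coarse components\<close>

definition chain :: "('a \<Rightarrow> 'a \<Rightarrow> real) \<Rightarrow> real \<Rightarrow> 'a set \<Rightarrow> ('a \<times> 'a) set" where
  "chain d r A = {(x, y). x \<in> A \<and> y \<in> A \<and> d x y \<le> r}\<^sup>*"

text \<open>A family of \<open>B\<close>-bounded sets that are more than \<open>r\<close> apart is represented by its union \<open>A\<close>: the
finest family with this union and members more than \<open>r\<close> apart consists of the classes of points
that are joined by chains with steps of length at most \<open>r\<close>, so it suffices to bound these. This avoids any bookkeeping of the members of the family.\<close>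

definition comp_bounded :: "('a \<Rightarrow> 'a \<Rightarrow> real) \<Rightarrow> real \<Rightarrow> real \<Rightarrow> 'a set \<Rightarrow> bool" where
  "comp_bounded d r B A \<longleftrightarrow> (\<forall>x\<in>A. \<forall>y. (x, y) \<in> chain d r A \<longrightarrow> d x y \<le> B)"

lemma comp_boundedD: "comp_bounded d r B A \<Longrightarrow> x \<in> A \<Longrightarrow> (x, y) \<in> chain d r A \<Longrightarrow> d x y \<le> B"
  by (auto simp: comp_bounded_def)

lemma chain_refl: "(x, x) \<in> chain d r A"
  by (simp add: chain_def)

lemma chain_step:
  "(x, y) \<in> chain d r A \<Longrightarrow> y \<in> A \<Longrightarrow> z \<in> A \<Longrightarrow> d y z \<le> r \<Longrightarrow> (x, z) \<in> chain d r A"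
  unfolding chain_def by (erule rtrancl_into_rtrancl) simp

lemma chain_trans: "(x, y) \<in> chain d r A \<Longrightarrow> (y, z) \<in> chain d r A \<Longrightarrow> (x, z) \<in> chain d r A"
  unfolding chain_def by (rule rtrancl_trans)

lemma chain_induct [consumes 1, case_names refl step]:
  assumes "(x, y) \<in> chain d r A" "P x"
    and "\<And>y z. (x, y) \<in> chain d r A \<Longrightarrow> y \<in> A \<Longrightarrow> z \<in> A \<Longrightarrow> d y z \<le> r \<Longrightarrow> P y \<Longrightarrow> P z"
  shows "P y"
  using assms unfolding chain_def by (induction rule: rtrancl_induct) auto

lemma chain_in: "(x, y) \<in> chain d r A \<Longrightarrow> x \<in> A \<Longrightarrow> y \<in> A"
  by (induction rule: chain_induct) auto

lemma chain_map:
  assumes "(x, y) \<in> chain d r A"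
    and "\<And>u v. u \<in> A \<Longrightarrow> v \<in> A \<Longrightarrow> d u v \<le> r \<Longrightarrow>
      \<phi> u \<in> A' \<and> \<phi> v \<in> A' \<and> d' (\<phi> u) (\<phi> v) \<le> r'"
  shows "(\<phi> x, \<phi> y) \<in> chain d' r' A'"
  using assms(1)
proof (induction rule: chain_induct)
  case refl
  show ?case by (rule chain_refl)
next
  case (step y z)
  then show ?case using assms(2)[of y z] chain_step[of "\<phi> x" "\<phi> y" d' r' A' "\<phi> z"] by simp
qed

lemma comp_bounded_isometry:
  assumes "comp_bounded d' r B A'" and "\<phi> ` A \<subseteq> A'"
    and "\<And>u v. u \<in> A \<Longrightarrow> v \<in> A \<Longrightarrow> d' (\<phi> u) (\<phi> v) = d u v"
  shows "comp_bounded d r B A"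
  unfolding comp_bounded_def
proof (intro ballI allI impI)
  fix x y assume x: "x \<in> A" and xy: "(x, y) \<in> chain d r A"
  have "(\<phi> x, \<phi> y) \<in> chain d' r A'"
    using xy by (rule chain_map) (use assms in auto)
  moreover have "y \<in> A" using xy x by (rule chain_in)
  ultimately show "d x y \<le> B"
    using comp_boundedD[OF assms(1), of "\<phi> x" "\<phi> y"] x assms(2,3) by auto
qed

lemma comp_bounded_mono:
  assumes "comp_bounded d r B A" "A' \<subseteq> A" "B \<le> B'"
  shows "comp_bounded d r B' A'"
  using comp_bounded_isometry[OF assms(1), of id A' d] assms(2,3)
  by (force simp: comp_bounded_def)

lemma comp_bounded_empty: "comp_bounded d r B {}"
  by (simp add: comp_bounded_def)

context Metric_space
begin

lemma chain_sym: "(x, y) \<in> chain d r A \<Longrightarrow> (y, x) \<in> chain d r A"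
  unfolding chain_def
  by (rule symD[OF sym_rtrancl]) (auto simp: sym_def commute)

lemma chain_class_eq:
  assumes "(x, y) \<in> chain d r A"
  shows "{z. (x, z) \<in> chain d r A} = {z. (y, z) \<in> chain d r A}"
  using chain_trans[OF assms] chain_trans[OF chain_sym[OF assms]] by blast

text \<open>The members of the cover are the chain classes, and distinct classes are more than \<open>r\<close> apart.\<close>

lemma comp_bounded_imp_asdim_le:
  assumes "\<And>r. r > 0 \<Longrightarrow> \<exists>C B. (\<Union>i\<le>n. C i) = A \<and> (\<forall>i\<le>n. comp_bounded d r B (C i))"
  shows "asdim_le A d n"
  unfolding asdim_le_def
proof (intro allI impI)
  fix r :: real assume "r > 0"
  then obtain C B where C: "(\<Union>i\<le>n. C i) = A" "\<And>i. i \<le> n \<Longrightarrow> comp_bounded d r B (C i)"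
    using assms by blast
  define \<U> where "\<U> i = (\<lambda>x. {y. (x, y) \<in> chain d r (C i)}) ` C i" for i
  show "\<exists>\<U>. (\<Union>i\<le>n. \<Union>(\<U> i)) = A \<and>
        (\<forall>i\<le>n. \<forall>U\<in>\<U> i. \<forall>V\<in>\<U> i. U \<noteq> V \<longrightarrow> ereal r \<le> set_distance d U V) \<and>
        (\<exists>D>0. \<forall>i\<le>n. \<forall>U\<in>\<U> i. set_diameter d U \<le> ereal D)"
  proof (intro exI[of _ \<U>] conjI allI impI ballI exI[of _ "max B 1"])
    have "\<Union>(\<U> i) = C i" for i
    proof (intro equalityI subsetI)
      fix y assume "y \<in> \<Union>(\<U> i)"
      then obtain x where "x \<in> C i" "(x, y) \<in> chain d r (C i)" unfolding \<U>_def by blast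
      then show "y \<in> C i" by (metis chain_in)
    next
      fix y assume "y \<in> C i"
      moreover have "(y, y) \<in> chain d r (C i)" by (rule chain_refl)
      ultimately show "y \<in> \<Union>(\<U> i)" unfolding \<U>_def by blast
    qed
    then show "(\<Union>i\<le>n. \<Union>(\<U> i)) = A" using C by simp
    show "0 < max B 1" by simp
    show "ereal r \<le> set_distance d U V"
      if i: "i \<le> n" and UV: "U \<in> \<U> i" "V \<in> \<U> i" "U \<noteq> V" for i U V
      unfolding set_distance_def
    proof (intro INF_greatest)
      fix u v assume uv: "u \<in> U" "v \<in> V"
      obtain x y where x: "x \<in> C i" "U = {z. (x, z) \<in> chain d r (C i)}"
        and y: "y \<in> C i" "V = {z. (y, z) \<in> chain d r (C i)}"
        using UV unfolding \<U>_def by blast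
      have xu: "(x, u) \<in> chain d r (C i)" and yv: "(y, v) \<in> chain d r (C i)"
        using x y uv by auto
      have "\<not> d u v \<le> r"
      proof
        assume "d u v \<le> r"
        then have xv: "(x, v) \<in> chain d r (C i)"
          using chain_step[OF xu chain_in[OF xu x(1)] chain_in[OF yv y(1)]] by simp
        have "U = V"
          unfolding x y chain_class_eq[OF yv] chain_class_eq[OF xv] ..
        then show False using UV by simp
      qed
      then show "ereal r \<le> ereal (d u v)" by simp
    qed
    show "set_diameter d U \<le> ereal (max B 1)" if i: "i \<le> n" and U: "U \<in> \<U> i" for i U
      unfolding set_diameter_def
    proof (intro SUP_least)
      fix u v assume uv: "u \<in> U" "v \<in> U"
      obtain x where x: "x \<in> C i" "U = {z. (x, z) \<in> chain d r (C i)}"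
        using U unfolding \<U>_def by blast
      have xu: "(x, u) \<in> chain d r (C i)" and xv: "(x, v) \<in> chain d r (C i)"
        using x uv by auto
      have "(u, v) \<in> chain d r (C i)" using chain_trans[OF chain_sym[OF xu] xv] .
      moreover have "u \<in> C i" using xu x(1) by (rule chain_in)
      ultimately have "d u v \<le> max B 1"
        using comp_boundedD[OF C(2)[OF i], of u v] by simp
      then show "ereal (d u v) \<le> ereal (max B 1)" by (simp only: ereal_less_eq)
    qed
  qed
qed

text \<open>A chain with steps of length at most \<open>r\<close> cannot leave a member of a family whose members are at
distance at least \<open>r + 1\<close>.\<close>

lemma asdim_le_imp_comp_bounded:
  assumes "asdim_le A d n"
  shows "\<exists>C B. (\<Union>i\<le>n. C i) = A \<and> (\<forall>i\<le>n. comp_bounded d r B (C i))"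
proof -
  define t where "t = max r 0 + 1"
  have "t > 0" by (simp add: t_def)
  then obtain \<U> B where cov: "(\<Union>i\<le>n. \<Union>(\<U> i)) = A"
    and far: "\<And>i U V. i \<le> n \<Longrightarrow> U \<in> \<U> i \<Longrightarrow> V \<in> \<U> i \<Longrightarrow> U \<noteq> V \<Longrightarrow> ereal t \<le> set_distance d U V"
    and bnd: "\<And>i U. i \<le> n \<Longrightarrow> U \<in> \<U> i \<Longrightarrow> set_diameter d U \<le> ereal B"
    using assms unfolding asdim_le_def by metis
  have "comp_bounded d r B (\<Union>(\<U> i))" if i: "i \<le> n" for i
    unfolding comp_bounded_def
  proof (intro ballI allI impI)
    fix x y assume x: "x \<in> \<Union>(\<U> i)" and xy: "(x, y) \<in> chain d r (\<Union>(\<U> i))"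
    obtain U where U: "U \<in> \<U> i" "x \<in> U" using x by blast
    from xy have "y \<in> U"
    proof (induction rule: chain_induct)
      case refl
      show ?case by (rule U)
    next
      case (step y z)
      then obtain V where V: "V \<in> \<U> i" "z \<in> V" by blast
      have "U = V"
      proof (rule ccontr)
        assume "U \<noteq> V"
        then have "t \<le> d y z"
          using far[OF i U(1) V(1)] step V by (simp add: set_distance_def le_INF_iff)
        then show False using step by (simp add: t_def)
      qed
      then show ?case using V by simp
    qed
    then show "d x y \<le> B"
      using bnd[OF i U(1)] U by (simp add: set_diameter_def SUP_le_iff)
  qed
  then show ?thesis using cov by (intro exI[of _ "\<lambda>i. \<Union>(\<U> i)"] exI[of _ B]) auto
qed

section \<open>Unions, and covers of higher multiplicity\<close>

text \<open>The union theorem at the level of components: the scale at which \<open>A2\<close> is cut exceeds the size of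
the components of \<open>A1\<close>. Between two visits of \<open>A2\<close>, an \<open>r\<close>-chain makes an excursion inside one
component of \<open>A1\<close>, hence consecutive visits are at distance at most \<open>r + b + r\<close> and all of them
belong to one component of \<open>A2\<close> at the scale \<open>2 r + b\<close>.\<close>

lemma comp_bounded_Un:
  assumes M: "A1 \<subseteq> M" "A2 \<subseteq> M" and pos: "0 \<le> r" "0 \<le> b" "0 \<le> B"
    and b1: "comp_bounded d r b A1" and b2: "comp_bounded d (2 * r + b) B A2"
  shows "comp_bounded d r (B + 2 * (r + b)) (A1 \<union> A2)"
  unfolding comp_bounded_def
proof (intro ballI allI impI)
  fix x y assume x: "x \<in> A1 \<union> A2" and xy: "(x, y) \<in> chain d r (A1 \<union> A2)"
  let ?C1 = "chain d r A1" and ?C2 = "chain d (2 * r + b) A2"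
  \<comment> \<open>\<open>reach y\<close>: the chain has visited \<open>A2\<close>, first at \<open>a\<close> and most recently at \<open>c\<close>, and \<open>tail c y\<close>
    describes the part after \<open>c\<close>.\<close>
  define tail where "tail c y \<longleftrightarrow> y = c \<or> (\<exists>z\<in>A1. d c z \<le> r \<and> (z, y) \<in> ?C1)" for c y
  have tail: "y \<in> A1 \<union> A2" "d c y \<le> r + b" if "tail c y" "c \<in> A2" for c y
  proof -
    have *: "y \<in> A1 \<and> d c y \<le> r + b" if z: "z \<in> A1" "d c z \<le> r" "(z, y) \<in> ?C1" for z
    proof -
      have "y \<in> A1" using chain_in[OF z(3,1)] .
      moreover have "d z y \<le> b" using comp_boundedD[OF b1 z(1,3)] .
      moreover have "c \<in> M" "z \<in> M" "y \<in> M" using calculation(1) z M \<open>c \<in> A2\<close> by auto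
      ultimately show ?thesis using triangle[of c z y] z(2) by simp
    qed
    show "y \<in> A1 \<union> A2" using that * unfolding tail_def by blast
    show "d c y \<le> r + b" using that * M pos unfolding tail_def by auto
  qed
  define reach where "reach y \<longleftrightarrow>
    (\<exists>a\<in>A2. \<exists>c\<in>A2. d x a \<le> r + b \<and> (a, c) \<in> ?C2 \<and> tail c y)" for y
  from xy have "(x \<in> A1 \<and> (x, y) \<in> ?C1) \<or> reach y"
  proof (induction rule: chain_induct)
    case refl
    show ?case
    proof (cases "x \<in> A1")
      case False
      then have "x \<in> A2" using x by simp
      moreover have "d x x \<le> r + b" using \<open>x \<in> A2\<close> M pos by auto
      moreover have "(x, x) \<in> ?C2" by (rule chain_refl)
      ultimately have "reach x" unfolding reach_def tail_def by blast
      then show ?thesis ..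
    qed (simp add: chain_refl)
  next
    case (step y z)
    have yM: "y \<in> M" "z \<in> M" "x \<in> M" using step x M by auto
    from step.IH show ?case
    proof
      assume 1: "x \<in> A1 \<and> (x, y) \<in> ?C1"
      then have y: "y \<in> A1" by (metis chain_in)
      show ?thesis
      proof (cases "z \<in> A1")
        case True
        then show ?thesis using 1 chain_step[of x y d r A1 z] y step(4) by simp
      next
        case False
        then have z: "z \<in> A2" using step by simp
        have "d x y \<le> b" using comp_boundedD[OF b1, of x y] 1 by simp
        then have "d x z \<le> r + b" using triangle[of x y z] yM step by simp
        moreover have "(z, z) \<in> ?C2" by (rule chain_refl)
        ultimately have "reach z" unfolding reach_def tail_def using z by blast
        then show ?thesis ..
      qed
    next
      assume "reach y"
      then obtain a c where ac: "a \<in> A2" "c \<in> A2" "d x a \<le> r + b" "(a, c) \<in> ?C2" "tail c y"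
        unfolding reach_def by blast
      show ?thesis
      proof (cases "z \<in> A2")
        case True
        have "d c z \<le> 2 * r + b"
          using triangle[of c y z] tail[OF ac(5,2)] step(4) yM ac(2) M(2) by (simp add: subset_iff)
        then have "(a, z) \<in> ?C2" by (rule chain_step[OF ac(4,2) True])
        then show ?thesis using ac True unfolding reach_def tail_def by blast
      next
        case False
        then have z: "z \<in> A1" using step by simp
        have "tail c z"
          using ac(5) unfolding tail_def
        proof (elim disjE bexE conjE)
          assume "y = c"
          then show "z = c \<or> (\<exists>za\<in>A1. d c za \<le> r \<and> (za, z) \<in> ?C1)"
            using z step(4) chain_refl[of z d r A1] by blast
        next
          fix w assume w: "w \<in> A1" "d c w \<le> r" "(w, y) \<in> ?C1"
          then have "(w, z) \<in> ?C1" using chain_step[OF w(3) chain_in[OF w(3,1)] z step(4)] by simp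
          then show "z = c \<or> (\<exists>za\<in>A1. d c za \<le> r \<and> (za, z) \<in> ?C1)" using w by blast
        qed
        then show ?thesis using ac unfolding reach_def by blast
      qed
    qed
  qed
  then show "d x y \<le> B + 2 * (r + b)"
  proof
    assume "x \<in> A1 \<and> (x, y) \<in> ?C1"
    then have "d x y \<le> b" using comp_boundedD[OF b1, of x y] by simp
    then show ?thesis using pos by simp
  next
    assume "reach y"
    then obtain a c where ac: "a \<in> A2" "c \<in> A2" "d x a \<le> r + b" "(a, c) \<in> ?C2" "tail c y"
      unfolding reach_def by blast
    have "d a c \<le> B" using comp_boundedD[OF b2 ac(1,4)] .
    moreover have "d c y \<le> r + b" "y \<in> M" using tail[OF ac(5,2)] M by auto
    moreover have "x \<in> M" "a \<in> M" "c \<in> M" using x ac M by auto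
    ultimately show ?thesis
      using triangle[of x a y] triangle[of a c y] ac(3) by simp
  qed
qed

text \<open>Kolmogorov's trick. The old sets are replaced by their \<open>r\<close>-neighbourhoods \<open>N i\<close>, which are
bounded at scale \<open>r\<close> as the old ones are at scale \<open>3 r\<close>. The new set \<open>L\<close> consists of the points
that lie in at most \<open>m + 1\<close> neighbourhoods. Along an \<open>r\<close>-chain in \<open>L\<close> the indices \<open>i\<close> with
\<open>y \<in> C i\<close> do not change: they number at least \<open>m + 1\<close> and are among the indices, at most \<open>m + 1\<close>,
of the neighbourhoods that contain the adjacent point. So the chain stays in a single old set.\<close>

lemma kolmogorov_step:
  assumes Y: "Y \<subseteq> M" and r: "0 \<le> r"
    and sub: "\<And>i. i < k \<Longrightarrow> C i \<subseteq> Y"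
    and bnd: "\<And>i. i < k \<Longrightarrow> comp_bounded d (3 * r) B (C i)"
    and mult: "\<And>y. y \<in> Y \<Longrightarrow> Suc m \<le> card {i. i < k \<and> y \<in> C i}"
  shows "\<exists>C'. (\<forall>i<Suc k. C' i \<subseteq> Y \<and> comp_bounded d r (B + 2 * r) (C' i)) \<and>
    (\<forall>y\<in>Y. Suc (Suc m) \<le> card {i. i < Suc k \<and> y \<in> C' i})"
proof -
  define N where "N i = {y \<in> Y. \<exists>a\<in>C i. d a y \<le> r}" for i
  define T where "T y = {i. i < k \<and> y \<in> N i}" for y
  define T0 where "T0 y = {i. i < k \<and> y \<in> C i}" for y
  define L where "L = {y \<in> Y. card (T y) \<le> Suc m}"
  have fin: "finite (T y)" "finite (T0 y)" for y unfolding T_def T0_def by auto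
  have T0T: "T0 z \<subseteq> T y" if "y \<in> Y" "z \<in> Y" "d y z \<le> r" for y z
    using that unfolding T_def T0_def N_def by (auto simp: commute)
  have self: "T0 y \<subseteq> T y" if "y \<in> Y" for y
    by (rule T0T) (use that Y r in \<open>auto simp: subset_iff\<close>)
  have eqL: "T0 y = T y" if "y \<in> L" for y
    using that mult[of y] self[of y] fin unfolding L_def T0_def[symmetric]
    by (intro card_seteq) auto
  have bN: "comp_bounded d r (B + 2 * r) (N i)" if i: "i < k" for i
    unfolding comp_bounded_def
  proof (intro ballI allI impI)
    fix x y assume x: "x \<in> N i" and xy: "(x, y) \<in> chain d r (N i)"
    \<comment> \<open>An \<open>r\<close>-chain in the neighbourhood is pushed to a \<open>3 r\<close>-chain in \<open>C i\<close> by choosing close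
      points of \<open>C i\<close>.\<close>
    define p where "p y = (SOME a. a \<in> C i \<and> d a y \<le> r)" for y
    have p: "p y \<in> C i" "d (p y) y \<le> r" "p y \<in> M" "y \<in> M" if "y \<in> N i" for y
    proof -
      have "\<exists>a. a \<in> C i \<and> d a y \<le> r" using that unfolding N_def by blast
      from someI_ex[OF this] show "p y \<in> C i" "d (p y) y \<le> r" unfolding p_def by auto
      then show "p y \<in> M" using sub[OF i] Y by blast
      show "y \<in> M" using that Y unfolding N_def by blast
    qed
    have "(p x, p y) \<in> chain d (3 * r) (C i)"
      using xy
    proof (rule chain_map)
      fix u v assume uv: "u \<in> N i" "v \<in> N i" "d u v \<le> r"
      have "d (p u) (p v) \<le> d (p u) u + (d u v + d v (p v))"
        using triangle[of "p u" u "p v"] triangle[of u v "p v"] p[OF uv(1)] p[OF uv(2)] by simp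
      also have "\<dots> \<le> 3 * r" using p[OF uv(1)] p[OF uv(2)] uv(3) by (simp add: commute)
      finally show "p u \<in> C i \<and> p v \<in> C i \<and> d (p u) (p v) \<le> 3 * r" using p uv by auto
    qed
    then have "d (p x) (p y) \<le> B" using comp_boundedD[OF bnd[OF i]] p x by blast
    moreover have y: "y \<in> N i" using chain_in[OF xy x] .
    ultimately have "d x y \<le> r + (B + r)"
      using triangle[of x "p x" y] triangle[of "p x" "p y" y] p[OF x] p[OF y]
      by (simp add: commute)
    then show "d x y \<le> B + 2 * r" by simp
  qed
  have bL: "comp_bounded d r (B + 2 * r) L"
    unfolding comp_bounded_def
  proof (intro ballI allI impI)
    fix x y assume x: "x \<in> L" and xy: "(x, y) \<in> chain d r L"
    have LY: "z \<in> Y" if "z \<in> L" for z using that by (simp add: L_def)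
    have "T0 x \<noteq> {}" using mult[OF LY[OF x]] unfolding T0_def[symmetric] by auto
    then obtain i where i: "i \<in> T0 x" by blast
    have *: "(x, y) \<in> chain d (3 * r) (C i) \<and> i \<in> T0 y"
      using xy
    proof (induction rule: chain_induct)
      case refl
      show ?case using i chain_refl by auto
    next
      case (step y z)
      have "T0 y \<subseteq> T z" using T0T[of z y] step LY commute by metis
      then have iz: "i \<in> T0 z" using step eqL by blast
      have "y \<in> C i" "z \<in> C i" "d y z \<le> 3 * r"
        using step iz r unfolding T0_def by auto
      then show ?case using step.IH iz chain_step[of x y d "3 * r" "C i" z] by simp
    qed
    have "i < k" "x \<in> C i" using i unfolding T0_def by auto
    then have "d x y \<le> B" using comp_boundedD[OF bnd, of i x y] * by simp
    then show "d x y \<le> B + 2 * r" using r by simp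
  qed
  define C' where "C' i = (if i < k then N i else L)" for i
  have "Suc (Suc m) \<le> card {i. i < Suc k \<and> y \<in> C' i}" if y: "y \<in> Y" for y
  proof (cases "y \<in> L")
    case True
    have "insert k (T y) \<subseteq> {i. i < Suc k \<and> y \<in> C' i}"
      using True unfolding T_def C'_def by auto
    then have "card (insert k (T y)) \<le> card {i. i < Suc k \<and> y \<in> C' i}"
      by (intro card_mono) auto
    moreover have "k \<notin> T y" by (simp add: T_def)
    moreover have "card (T0 y) \<le> card (T y)" using self[OF y] fin by (intro card_mono)
    ultimately show ?thesis using mult[OF y] fin unfolding T0_def[symmetric] by simp
  next
    case False
    have "T y \<subseteq> {i. i < Suc k \<and> y \<in> C' i}"
      unfolding T_def C'_def by auto
    then have "card (T y) \<le> card {i. i < Suc k \<and> y \<in> C' i}"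
      by (intro card_mono) auto
    then show ?thesis using False y unfolding L_def by simp
  qed
  moreover have "C' i \<subseteq> Y \<and> comp_bounded d r (B + 2 * r) (C' i)" if "i < Suc k" for i
    using bN bL unfolding C'_def by (auto simp: N_def L_def)
  ultimately show ?thesis by blast
qed

lemma kolmogorov_trick:
  assumes Y: "Y \<subseteq> M" and "asdim_le Y d n" and r: "0 \<le> r"
  shows "\<exists>C B. (\<forall>i<Suc (n + m). C i \<subseteq> Y \<and> comp_bounded d r B (C i)) \<and>
    (\<forall>y\<in>Y. Suc m \<le> card {i. i < Suc (n + m) \<and> y \<in> C i})"
  using r
proof (induction m arbitrary: r)
  case 0
  obtain C B where C: "(\<Union>i\<le>n. C i) = Y" "\<forall>i\<le>n. comp_bounded d r B (C i)"
    using asdim_le_imp_comp_bounded[OF assms(2)] by metis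
  have "Suc 0 \<le> card {i. i < Suc n \<and> y \<in> C i}" if "y \<in> Y" for y
  proof -
    have "{i. i < Suc n \<and> y \<in> C i} \<noteq> {}" using that C(1) by (auto simp: less_Suc_eq_le)
    moreover have "finite {i. i < Suc n \<and> y \<in> C i}" by simp
    ultimately show ?thesis by (simp add: card_gt_0_iff Suc_le_eq)
  qed
  then show ?case using C by (intro exI[of _ C] exI[of _ B]) (auto simp: less_Suc_eq_le)
next
  case (Suc m)
  have "0 \<le> 3 * r" using Suc.prems by simp
  from Suc.IH[OF this] obtain C B where
    C: "\<And>i. i < Suc (n + m) \<Longrightarrow> C i \<subseteq> Y"
      "\<And>i. i < Suc (n + m) \<Longrightarrow> comp_bounded d (3 * r) B (C i)"
      "\<And>y. y \<in> Y \<Longrightarrow> Suc m \<le> card {i. i < Suc (n + m) \<and> y \<in> C i}"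
    by metis
  from kolmogorov_step[OF Y Suc.prems C]
  have "\<exists>C'. (\<forall>i<Suc (Suc (n + m)). C' i \<subseteq> Y \<and> comp_bounded d r (B + 2 * r) (C' i)) \<and>
    (\<forall>y\<in>Y. Suc (Suc m) \<le> card {i. i < Suc (Suc (n + m)) \<and> y \<in> C' i})" .
  then show ?case by auto
qed

end

section \<open>Colourings and the Hurewicz inequality\<close>

text \<open>The countable graph is coloured along an enumeration: each vertex takes the least colour that no
earlier neighbour has. At most \<open>N\<close> colours are excluded, so one of \<open>0, \<dots>, N\<close> is free.\<close>

lemma greedy_colouring:
  fixes E :: "'a \<Rightarrow> 'a \<Rightarrow> bool"
  assumes "countable Y" and sym: "\<And>x y. E x y \<Longrightarrow> E y x"
    and deg: "\<And>y. y \<in> Y \<Longrightarrow> finite {z \<in> Y. E y z} \<and> card {z \<in> Y. E y z} \<le> N"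
  shows "\<exists>c :: 'a \<Rightarrow> nat. (\<forall>y\<in>Y. c y \<le> N) \<and> (\<forall>y\<in>Y. \<forall>z\<in>Y. y \<noteq> z \<longrightarrow> E y z \<longrightarrow> c y \<noteq> c z)"
proof -
  define num where "num = to_nat_on Y"
  have inj: "inj_on num Y" unfolding num_def using assms(1) by (rule inj_on_to_nat_on)
  define R where "R = measure num"
  have wf: "wf R" by (simp add: R_def)
  define used where "used c y = c ` {z \<in> Y. E y z \<and> num z < num y}" for c :: "'a \<Rightarrow> nat" and y
  define c where "c = wfrec R (\<lambda>c y. LEAST t. t \<notin> used c y)"
  have c: "c y = (LEAST t. t \<notin> used c y)" for y
  proof -
    have "used (cut c R y) y = used c y" unfolding used_def
      by (rule image_cong) (auto simp: cut_apply R_def)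
    then show ?thesis using wfrec[OF wf, of "\<lambda>c y. LEAST t. t \<notin> used c y" y]
      unfolding c_def[symmetric] by simp
  qed
  have used: "finite (used c y) \<and> card (used c y) \<le> N" if "y \<in> Y" for y
  proof -
    have fin: "finite {z \<in> Y. E y z \<and> num z < num y}"
      using deg[OF that] by (auto elim: rev_finite_subset)
    have "card (used c y) \<le> card {z \<in> Y. E y z \<and> num z < num y}"
      unfolding used_def using fin by (rule card_image_le)
    also have "\<dots> \<le> card {z \<in> Y. E y z}" using deg[OF that] by (intro card_mono) auto
    finally show ?thesis using deg[OF that] fin by (auto simp: used_def)
  qed
  have free: "\<exists>t\<le>N. t \<notin> used c y" if "y \<in> Y" for y
  proof (rule ccontr)
    assume "\<not> ?thesis"
    then have "{..N} \<subseteq> used c y" by auto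
    then have "card {..N} \<le> card (used c y)" using used[OF that] by (intro card_mono) auto
    then show False using used[OF that] by simp
  qed
  have le: "c y \<le> N" if "y \<in> Y" for y
    using free[OF that] Least_le[of "\<lambda>t. t \<notin> used c y"] unfolding c[of y] by (meson le_trans)
  have ne: "c y \<notin> used c y" if "y \<in> Y" for y
    unfolding c[of y] using free[OF that] by (metis (mono_tags, lifting) LeastI)
  have "c y \<noteq> c z" if yz: "y \<in> Y" "z \<in> Y" "y \<noteq> z" "E y z" for y z
  proof -
    have "num y \<noteq> num z" using inj yz by (auto dest: inj_onD)
    then consider "num y < num z" | "num z < num y" by linarith
    then show ?thesis
    proof cases
      case 1
      then have "c y \<in> used c z" using yz sym[OF yz(4)] unfolding used_def by blast
      then show ?thesis using ne[OF yz(2)] by metis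
    next
      case 2
      then have "c z \<in> used c y" using yz unfolding used_def by blast
      then show ?thesis using ne[OF yz(1)] by metis
    qed
  qed
  then show ?thesis using le by blast
qed


text \<open>A Hurewicz inequality for a map \<open>f\<close> to a space of bounded geometry. In such a space it suffices
to control the fibres over single points, uniformly, instead of the preimages of all
bounded sets.\<close>

theorem asdim_le_hurewicz:
  fixes f :: "'a \<Rightarrow> 'b"
  assumes X: "Metric_space M d" "A \<subseteq> M"
    and Y: "Metric_space N e" "B \<subseteq> N" "countable B"
    and f: "f ` A \<subseteq> B"
    and born: "\<And>r. \<exists>s. \<forall>x\<in>A. \<forall>x'\<in>A. d x x' \<le> r \<longrightarrow> e (f x) (f x') \<le> s"
    and bg: "\<And>R. \<exists>K. \<forall>y\<in>B. finite {z \<in> B. e y z \<le> R} \<and> card {z \<in> B. e y z \<le> R} \<le> K"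
    and fib: "\<And>r. \<exists>b. \<forall>y\<in>B. \<exists>C. {x \<in> A. f x = y} \<subseteq> (\<Union>j\<le>m. C j) \<and>
      (\<forall>j\<le>m. comp_bounded d r b (C j))"
    and le: "asdim_le B e n"
  shows "asdim_le A d (n + m)"
proof -
  interpret X: Metric_space M d by fact
  interpret Y: Metric_space N e by fact
  show ?thesis
  proof (rule X.comp_bounded_imp_asdim_le)
    fix r :: real assume r: "r > 0"
    obtain s0 where s0: "\<And>x x'. x \<in> A \<Longrightarrow> x' \<in> A \<Longrightarrow> d x x' \<le> r \<Longrightarrow> e (f x) (f x') \<le> s0"
      using born[of r] by blast
    define s where "s = max s0 0"
    have s: "0 \<le> s" "\<And>x x'. x \<in> A \<Longrightarrow> x' \<in> A \<Longrightarrow> d x x' \<le> r \<Longrightarrow> e (f x) (f x') \<le> s"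
      using s0 by (auto simp: s_def le_max_iff_disj)
    obtain V R where V: "\<And>i. i < Suc (n + m) \<Longrightarrow> V i \<subseteq> B"
        "\<And>i. i < Suc (n + m) \<Longrightarrow> comp_bounded e s R (V i)"
      and mult: "\<And>y. y \<in> B \<Longrightarrow> Suc m \<le> card {i. i < Suc (n + m) \<and> y \<in> V i}"
      using Y.kolmogorov_trick[OF Y(2) le s(1), of m] by metis
    define T where "T y = {i. i < Suc (n + m) \<and> y \<in> V i}" for y
    have "\<exists>g. g ` {..m} \<subseteq> T y \<and> inj_on g {..m}" if "y \<in> B" for y
      using mult[OF that] unfolding T_def[symmetric]
      by (intro card_le_inj) (auto simp: T_def)
    then obtain g where g: "\<And>y. y \<in> B \<Longrightarrow> g y ` {..m} \<subseteq> T y"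
        and g_inj: "\<And>y. y \<in> B \<Longrightarrow> inj_on (g y) {..m}"
      by metis
    obtain K where K: "\<And>y. y \<in> B \<Longrightarrow> finite {z \<in> B. e y z \<le> R} \<and> card {z \<in> B. e y z \<le> R} \<le> K"
      using bg[of R] by blast
    have "\<exists>c :: 'b \<Rightarrow> nat. (\<forall>y\<in>B. c y \<le> K) \<and>
      (\<forall>y\<in>B. \<forall>z\<in>B. y \<noteq> z \<longrightarrow> e y z \<le> R \<longrightarrow> c y \<noteq> c z)"
      using Y(3)
    proof (rule greedy_colouring)
      show "e z y \<le> R" if "e y z \<le> R" for y z
        using that by (simp add: Y.commute)
    qed (rule K)
    then obtain c :: "'b \<Rightarrow> nat" where c_all: "(\<forall>y\<in>B. c y \<le> K) \<and>
      (\<forall>y\<in>B. \<forall>z\<in>B. y \<noteq> z \<longrightarrow> e y z \<le> R \<longrightarrow> c y \<noteq> c z)" ..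
    have c: "c y \<le> K" if "y \<in> B" for y using c_all that by simp
    have c_eq: "y = z" if "y \<in> B" "z \<in> B" "e y z \<le> R" "c y = c z" for y z
      using c_all that by auto
    define fine where "fine t b y C \<longleftrightarrow> {x \<in> A. f x = y} \<subseteq> (\<Union>j\<le>m. C j) \<and>
      (\<forall>j\<le>m. comp_bounded d t b (C j))" for t b y C
    have "\<exists>b\<ge>0. \<forall>y\<in>B. \<exists>C. fine t b y C" for t
    proof -
      obtain b where b: "\<forall>y\<in>B. \<exists>C. fine t b y C"
        using fib unfolding fine_def by blast
      have "comp_bounded d t (max b 0) C" if "comp_bounded d t b C" for C
        using that by (rule comp_bounded_mono) auto
      then have "fine t (max b 0) y C" if "fine t b y C" for y C
        using that unfolding fine_def by simp
      then have "\<forall>y\<in>B. \<exists>C. fine t (max b 0) y C" using b by meson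
      then show ?thesis by (intro exI[of _ "max b 0"]) simp
    qed
    then obtain \<beta> where \<beta>: "\<And>t. \<beta> t \<ge> 0" and "\<And>t. \<forall>y\<in>B. \<exists>C. fine t (\<beta> t) y C"
      by metis
    then obtain C where fine: "\<And>t y. y \<in> B \<Longrightarrow> fine t (\<beta> t) y (C t y)"
      by metis
    have C: "{x \<in> A. f x = y} \<subseteq> (\<Union>j\<le>m. C t y j)"
        "j \<le> m \<Longrightarrow> comp_bounded d t (\<beta> t) (C t y j)" if "y \<in> B" for t y j
      using fine[OF that, of t] unfolding fine_def by simp_all
    \<comment> \<open>\<open>b t\<close> bounds the components over the points with colours below \<open>t\<close>, and \<open>2 * r + b t\<close> is
      the scale for the colour \<open>t\<close>, in agreement with the union lemma.\<close>
    define b where "b = rec_nat 0 (\<lambda>_ b. \<beta> (2 * r + b) + 2 * (r + b))"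
    have b_0: "b 0 = 0" and b_Suc: "b (Suc t) = \<beta> (2 * r + b t) + 2 * (r + b t)" for t
      by (simp_all add: b_def)
    have b_nonneg: "b t \<ge> 0" for t
      by (induction t) (use \<beta> r in \<open>auto simp: b_0 b_Suc\<close>)
    define U where
      "U i = {x \<in> A. \<exists>j\<le>m. g (f x) j = i \<and> x \<in> C (2 * r + b (c (f x))) (f x) j}" for i
    have cover: "(\<Union>i\<le>n + m. U i) = A"
    proof (intro equalityI subsetI)
      fix x assume x: "x \<in> A"
      then have fx: "f x \<in> B" using f by blast
      obtain j where j: "j \<le> m" "x \<in> C (2 * r + b (c (f x))) (f x) j"
        using C(1)[OF fx, of "2 * r + b (c (f x))"] x by blast
      have "g (f x) j \<in> T (f x)" using g[OF fx] j(1) by blast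
      then have "g (f x) j \<le> n + m" by (auto simp: T_def)
      then show "x \<in> (\<Union>i\<le>n + m. U i)" using x j unfolding U_def by blast
    qed (auto simp: U_def)
    have "comp_bounded d r (b (Suc K)) (U i)" if i: "i \<le> n + m" for i
      unfolding comp_bounded_def
    proof (intro ballI allI impI)
      fix x x' assume x: "x \<in> U i" and xx': "(x, x') \<in> chain d r (U i)"
      have UA: "U i \<subseteq> A" by (auto simp: U_def)
      have fU: "f z \<in> V i" if "z \<in> U i" for z
        using that g[of "f z"] f unfolding U_def T_def by blast
      \<comment> \<open>\<open>Z\<close> is the part of \<open>U i\<close> over the component of \<open>f x\<close> in \<open>V i\<close>. Chains from \<open>x\<close> do
        not leave it, and any two of its points have images at distance at most \<open>R\<close>, hence images
        with different colours unless these are equal.\<close>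
      define Z where "Z = {z \<in> U i. (f x, f z) \<in> chain e s (V i)}"
      have Z: "Z \<subseteq> A" using UA by (auto simp: Z_def)
      have close: "e (f z) (f z') \<le> R" if "z \<in> Z" "z' \<in> Z" for z z'
      proof -
        have xz: "(f x, f z) \<in> chain e s (V i)" and xz': "(f x, f z') \<in> chain e s (V i)"
          using that unfolding Z_def by auto
        have "(f z, f z') \<in> chain e s (V i)"
          using chain_trans[OF Y.chain_sym[OF xz] xz'] .
        moreover have "f z \<in> V i" using that fU unfolding Z_def by blast
        moreover have "comp_bounded e s R (V i)" using V(2) i by simp
        ultimately show ?thesis by (metis comp_boundedD)
      qed
      have xZ: "x \<in> Z" using x chain_refl by (auto simp: Z_def)
      from xx' have "x' \<in> Z \<and> (x, x') \<in> chain d r Z"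
      proof (induction rule: chain_induct)
        case refl
        show ?case using xZ chain_refl by auto
      next
        case (step y z)
        have y: "y \<in> Z" "(f x, f y) \<in> chain e s (V i)" "(x, y) \<in> chain d r Z"
          using step.IH by (auto simp: Z_def)
        have "e (f y) (f z) \<le> s" using s(2) step UA by blast
        with y(2) fU[OF step(2)] fU[OF step(3)] have "(f x, f z) \<in> chain e s (V i)"
          by (rule chain_step)
        then have z: "z \<in> Z" using step unfolding Z_def by blast
        then show ?case using chain_step[OF y(3,1) z step(4)] by simp
      qed
      moreover have Zt: "comp_bounded d r (b t) {z \<in> Z. c (f z) < t}" for t
      proof (induction t)
        case 0
        show ?case by (simp add: comp_bounded_empty)
      next
        case (Suc t)
        define L where "L = {z \<in> Z. c (f z) = t}"
        have "comp_bounded d (2 * r + b t) (\<beta> (2 * r + b t)) L"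
        proof (cases "L = {}")
          case True
          then show ?thesis by (simp add: comp_bounded_empty)
        next
          case False
          then obtain z0 where z0: "z0 \<in> L" by blast
          define y where "y = f z0"
          have y: "y \<in> B" "c y = t" using z0 Z f unfolding y_def L_def by auto
          have piece: "f z = y \<and> (\<exists>j\<le>m. g y j = i \<and> z \<in> C (2 * r + b t) y j)"
            if z: "z \<in> L" for z
          proof -
            have "f z \<in> B" "c (f z) = c y" "e (f z) y \<le> R"
              using z z0 Z f close y unfolding L_def y_def by auto
            then have "f z = y" using c_eq y by blast
            then show ?thesis using z y(2) unfolding L_def Z_def U_def by auto
          qed
          \<comment> \<open>Labels are injective on the pieces of one fibre, hence only one piece of the fibre over
            \<open>y\<close> carries the label \<open>i\<close>.\<close>
          obtain j0 where j0: "j0 \<le> m" "g y j0 = i" using piece[OF z0] by blast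
          have "L \<subseteq> C (2 * r + b t) y j0"
          proof
            fix z assume "z \<in> L"
            then obtain j where j: "j \<le> m" "g y j = i" "z \<in> C (2 * r + b t) y j"
              using piece by blast
            then have "j = j0" using inj_onD[OF g_inj[OF y(1)], of j j0] j0 by simp
            then show "z \<in> C (2 * r + b t) y j0" using j by simp
          qed
          with C(2)[OF y(1) j0(1)] show ?thesis by (rule comp_bounded_mono) simp
        qed
        then have "comp_bounded d r (\<beta> (2 * r + b t) + 2 * (r + b t)) ({z \<in> Z. c (f z) < t} \<union> L)"
          using X(2) Z r b_nonneg \<beta> Suc by (intro X.comp_bounded_Un) (auto simp: L_def)
        moreover have "{z \<in> Z. c (f z) < t} \<union> L = {z \<in> Z. c (f z) < Suc t}"
          by (auto simp: L_def)
        ultimately show ?case by (simp add: b_Suc)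
      qed
      moreover have "{z \<in> Z. c (f z) < Suc K} = Z" using c Z f by (auto simp: less_Suc_eq_le)
      ultimately show "d x x' \<le> b (Suc K)"
        using comp_boundedD[OF Zt, of x "Suc K" x'] xZ by auto
    qed
    then show "\<exists>U b. (\<Union>i\<le>n + m. U i) = A \<and> (\<forall>i\<le>n + m. comp_bounded d r b (U i))"
      using cover by blast
  qed
qed

section \<open>Quasimorphisms and their fibres\<close>

lemma quasimorphism_mult:
  assumes "group P" "group Q" and f: "quasimorphism P Q f"
    and xy: "x \<in> carrier P" "y \<in> carrier P"
  shows "\<exists>\<delta>\<in>defect_set P Q f. \<delta> \<in> carrier Q \<and> f (x \<otimes>\<^bsub>P\<^esub> y) = f x \<otimes>\<^bsub>Q\<^esub> f y \<otimes>\<^bsub>Q\<^esub> \<delta>"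
proof -
  interpret P: group P by fact
  interpret Q: group Q by fact
  have fQ: "f x \<in> carrier Q" "f y \<in> carrier Q" "f (x \<otimes>\<^bsub>P\<^esub> y) \<in> carrier Q"
    using f xy unfolding quasimorphism_def by auto
  let ?\<delta> = "inv\<^bsub>Q\<^esub> (f y) \<otimes>\<^bsub>Q\<^esub> inv\<^bsub>Q\<^esub> (f x) \<otimes>\<^bsub>Q\<^esub> f (x \<otimes>\<^bsub>P\<^esub> y)"
  have "?\<delta> = inv\<^bsub>Q\<^esub> (f x \<otimes>\<^bsub>Q\<^esub> f y) \<otimes>\<^bsub>Q\<^esub> f (x \<otimes>\<^bsub>P\<^esub> y)"
    using fQ by (simp add: Q.inv_mult_group)
  then have "f x \<otimes>\<^bsub>Q\<^esub> f y \<otimes>\<^bsub>Q\<^esub> ?\<delta> = f (x \<otimes>\<^bsub>P\<^esub> y)"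
    using fQ by (simp add: Q.inv_solve_left Q.m_assoc[symmetric])
  moreover have "?\<delta> \<in> defect_set P Q f" using xy unfolding defect_set_def by blast
  moreover have "?\<delta> \<in> carrier Q" using fQ by simp
  ultimately show ?thesis by metis
qed

text \<open>Both \<open>f e = f (x\<inverse> x)\<close> and \<open>f (x\<inverse> x')\<close> differ from \<open>q = f (x\<inverse>) f x = f (x\<inverse>) f x'\<close> by
a defect on the right, say \<open>\<delta>\<close> and \<open>\<epsilon>\<close>. Eliminating \<open>q\<close> gives
\<open>f (x\<inverse> x') = f e \<delta>\<inverse> \<epsilon>\<close>.\<close>

lemma quasimorphism_fibre:
  assumes "group P" "group Q" and f: "quasimorphism P Q f"
    and x: "x \<in> carrier P" "x' \<in> carrier P" "f x = f x'"
  shows "f (inv\<^bsub>P\<^esub> x \<otimes>\<^bsub>P\<^esub> x') \<in>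
    f \<one>\<^bsub>P\<^esub> <#\<^bsub>Q\<^esub> (set_inv\<^bsub>Q\<^esub> (defect_set P Q f) <#>\<^bsub>Q\<^esub> defect_set P Q f)"
proof -
  interpret P: group P by fact
  interpret Q: group Q by fact
  have xi: "inv\<^bsub>P\<^esub> x \<in> carrier P" using x by simp
  have fQ: "f x \<in> carrier Q" "f (inv\<^bsub>P\<^esub> x) \<in> carrier Q"
    using f x xi unfolding quasimorphism_def by auto
  define q where "q = f (inv\<^bsub>P\<^esub> x) \<otimes>\<^bsub>Q\<^esub> f x"
  have q: "q \<in> carrier Q" using fQ by (simp add: q_def)
  obtain \<delta> where \<delta>: "\<delta> \<in> defect_set P Q f" "\<delta> \<in> carrier Q" "f \<one>\<^bsub>P\<^esub> = q \<otimes>\<^bsub>Q\<^esub> \<delta>"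
    using quasimorphism_mult[OF assms(1-3) xi x(1)] x unfolding q_def by auto
  obtain \<epsilon> where \<epsilon>: "\<epsilon> \<in> defect_set P Q f" "\<epsilon> \<in> carrier Q"
    "f (inv\<^bsub>P\<^esub> x \<otimes>\<^bsub>P\<^esub> x') = q \<otimes>\<^bsub>Q\<^esub> \<epsilon>"
    using quasimorphism_mult[OF assms(1-3) xi x(2)] x unfolding q_def by auto
  have "\<delta> \<otimes>\<^bsub>Q\<^esub> (inv\<^bsub>Q\<^esub> \<delta> \<otimes>\<^bsub>Q\<^esub> \<epsilon>) = \<epsilon>"
    using \<delta> \<epsilon> by (simp add: Q.m_assoc[symmetric])
  then have "f (inv\<^bsub>P\<^esub> x \<otimes>\<^bsub>P\<^esub> x') = f \<one>\<^bsub>P\<^esub> \<otimes>\<^bsub>Q\<^esub> (inv\<^bsub>Q\<^esub> \<delta> \<otimes>\<^bsub>Q\<^esub> \<epsilon>)"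
    using \<delta> \<epsilon> q by (simp add: Q.m_assoc)
  then show ?thesis
    using \<delta>(1) \<epsilon>(1) unfolding l_coset_def set_mult_def SET_INV_def by blast
qed

lemma proper_left_invariant_metric_shift:
  assumes "group G" "proper_left_invariant_metric G d" "x \<in> carrier G" "y \<in> carrier G"
  shows "d x y = d \<one>\<^bsub>G\<^esub> (inv\<^bsub>G\<^esub> x \<otimes>\<^bsub>G\<^esub> y)"
  using assms unfolding proper_left_invariant_metric_def
  by (metis group.inv_closed group.l_inv)

text \<open>If \<open>x' = x z\<close> with \<open>z\<close> in a ball about the identity, then \<open>(f x)\<inverse> f x'\<close> is \<open>f z\<close> times a defect.
Balls and the defect set are finite, which leaves finitely many values.\<close>

lemma quasimorphism_bornologous:
  assumes "group P" "group Q" and f: "quasimorphism P Q f"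
    and d: "proper_left_invariant_metric P d" and e: "proper_left_invariant_metric Q e"
  shows "\<exists>s. \<forall>x\<in>carrier P. \<forall>x'\<in>carrier P. d x x' \<le> r \<longrightarrow> e (f x) (f x') \<le> s"
proof -
  interpret P: group P by fact
  interpret Q: group Q by fact
  define S where "S = {z \<in> carrier P. d \<one>\<^bsub>P\<^esub> z \<le> r}"
  define W where "W = (\<lambda>(z, \<delta>). e \<one>\<^bsub>Q\<^esub> (f z \<otimes>\<^bsub>Q\<^esub> \<delta>)) ` (S \<times> defect_set P Q f)"
  have "finite S" unfolding S_def by (rule proper_left_invariant_metric_finite[OF d P.one_closed])
  then have "finite W" using f unfolding W_def quasimorphism_def by simp
  then have "bdd_above W" by simp
  then obtain s where s: "\<And>w. w \<in> W \<Longrightarrow> w \<le> s"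
    unfolding bdd_above_def by blast
  show ?thesis
  proof (intro exI[of _ s] ballI impI)
    fix x x' assume x: "x \<in> carrier P" "x' \<in> carrier P" "d x x' \<le> r"
    define z where "z = inv\<^bsub>P\<^esub> x \<otimes>\<^bsub>P\<^esub> x'"
    have z: "z \<in> carrier P" "x' = x \<otimes>\<^bsub>P\<^esub> z"
      using x by (simp_all add: z_def P.m_assoc[symmetric])
    have zS: "z \<in> S"
      using proper_left_invariant_metric_shift[OF assms(1) d x(1,2)] x(3) z
      unfolding S_def z_def by simp
    have fQ: "f x \<in> carrier Q" "f x' \<in> carrier Q" "f z \<in> carrier Q"
      using f x z unfolding quasimorphism_def by auto
    obtain \<delta> where \<delta>: "\<delta> \<in> defect_set P Q f" "\<delta> \<in> carrier Q" "f x' = f x \<otimes>\<^bsub>Q\<^esub> f z \<otimes>\<^bsub>Q\<^esub> \<delta>"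
      using quasimorphism_mult[OF assms(1-3) x(1) z(1)] z(2) by auto
    have "inv\<^bsub>Q\<^esub> (f x) \<otimes>\<^bsub>Q\<^esub> f x' = f z \<otimes>\<^bsub>Q\<^esub> \<delta>"
      using fQ \<delta> by (metis Q.inv_solve_left' Q.m_assoc Q.m_closed)
    then have "e (f x) (f x') = e \<one>\<^bsub>Q\<^esub> (f z \<otimes>\<^bsub>Q\<^esub> \<delta>)"
      using proper_left_invariant_metric_shift[OF assms(2) e fQ(1,2)] by simp
    also have "\<dots> \<in> W" using zS \<delta> unfolding W_def by force
    finally show "e (f x) (f x') \<le> s" by (rule s)
  qed
qed

lemma proper_left_invariant_metric_bounded_geometry:
  assumes "group G" and d: "proper_left_invariant_metric G d" and B: "B \<subseteq> carrier G"
  shows "\<exists>K. \<forall>y\<in>B. finite {z \<in> B. d y z \<le> R} \<and> card {z \<in> B. d y z \<le> R} \<le> K"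
proof -
  interpret group G by fact
  define S where "S = {z \<in> carrier G. d \<one>\<^bsub>G\<^esub> z \<le> R}"
  have S: "finite S" unfolding S_def by (rule proper_left_invariant_metric_finite[OF d one_closed])
  have "finite {z \<in> B. d y z \<le> R} \<and> card {z \<in> B. d y z \<le> R} \<le> card S" if y: "y \<in> B" for y
  proof -
    have yG: "y \<in> carrier G" using y B by blast
    have "{z \<in> B. d y z \<le> R} \<subseteq> (\<lambda>w. y \<otimes>\<^bsub>G\<^esub> w) ` S"
    proof
      fix z assume "z \<in> {z \<in> B. d y z \<le> R}"
      then have z: "z \<in> carrier G" "d y z \<le> R" using B by auto
      have "inv\<^bsub>G\<^esub> y \<otimes>\<^bsub>G\<^esub> z \<in> S"
        using proper_left_invariant_metric_shift[OF assms(1) d yG z(1)] z yG by (simp add: S_def)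
      moreover have "z = y \<otimes>\<^bsub>G\<^esub> (inv\<^bsub>G\<^esub> y \<otimes>\<^bsub>G\<^esub> z)"
        using z yG by (simp add: m_assoc[symmetric])
      ultimately show "z \<in> (\<lambda>w. y \<otimes>\<^bsub>G\<^esub> w) ` S" by blast
    qed
    then show ?thesis using S by (meson finite_imageI finite_subset surj_card_le)
  qed
  then show ?thesis by blast
qed

lemma asdim_le_attained:
  assumes "asdim A d = enat n"
  shows "asdim_le A d n"
proof -
  let ?S = "enat ` {n. asdim_le A d n}"
  have "?S \<noteq> {}" and "(LEAST x. x \<in> ?S) = enat n"
    using assms unfolding asdim_def Inf_enat_def by (auto split: if_splits)
  then have "enat n \<in> ?S" by (metis LeastI_ex ex_in_conv)
  then show ?thesis by auto
qed

text \<open>The Hurewicz inequality applies with proper left-invariant metrics on both groups: the pieces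
of a fibre are translates of the pieces of one cover of the set \<open>f\<inverse> (f(e) D\<inverse> D)\<close>, so the bound on
their components is the same for all fibres.\<close>

theorem quasimorphism_asdim_le:
  assumes P: "group P" "countable (carrier P)" and Q: "group Q" "countable (carrier Q)"
    and f: "quasimorphism P Q f"
    and AB: "A \<subseteq> carrier P" "B \<subseteq> carrier Q" "f ` A \<subseteq> B"
  defines "D \<equiv> defect_set P Q f"
  shows "group_asdim P A \<le> group_asdim Q B +
    group_asdim P (f -` (f \<one>\<^bsub>P\<^esub> <#\<^bsub>Q\<^esub> (set_inv\<^bsub>Q\<^esub> D <#>\<^bsub>Q\<^esub> D)) \<inter> carrier P)"
proof -
  interpret P: group P by fact
  define K where "K = f -` (f \<one>\<^bsub>P\<^esub> <#\<^bsub>Q\<^esub> (set_inv\<^bsub>Q\<^esub> D <#>\<^bsub>Q\<^esub> D)) \<inter> carrier P"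
  obtain d where d: "proper_left_invariant_metric P d"
    using ex_proper_left_invariant_metric[OF P] by blast
  obtain e where e: "proper_left_invariant_metric Q e"
    using ex_proper_left_invariant_metric[OF Q] by blast
  have met: "Metric_space (carrier P) d" "Metric_space (carrier Q) e"
    using d e by (auto simp: proper_left_invariant_metric_def)
  have main: "asdim A d \<le> enat (n + m)" if n: "asdim_le B e n" and m: "asdim_le K d m" for n m
  proof -
    have "asdim_le A d (n + m)"
    proof (rule asdim_le_hurewicz[OF met(1) AB(1) met(2) AB(2) _ AB(3) _ _ _ n])
      show "countable B" using Q(2) AB(2) countable_subset by blast
      show "\<exists>s. \<forall>x\<in>A. \<forall>x'\<in>A. d x x' \<le> r \<longrightarrow> e (f x) (f x') \<le> s" for r
        using quasimorphism_bornologous[OF P(1) Q(1) f d e, of r] AB(1) by blast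
      show "\<exists>K. \<forall>y\<in>B. finite {z \<in> B. e y z \<le> R} \<and> card {z \<in> B. e y z \<le> R} \<le> K" for R
        by (rule proper_left_invariant_metric_bounded_geometry[OF Q(1) e AB(2)])
      fix r
      obtain C b where C: "(\<Union>j\<le>m. C j) = K" "\<And>j. j \<le> m \<Longrightarrow> comp_bounded d r b (C j)"
        using Metric_space.asdim_le_imp_comp_bounded[OF met(1) m] by metis
      have "\<exists>C'. {x \<in> A. f x = y} \<subseteq> (\<Union>j\<le>m. C' j) \<and> (\<forall>j\<le>m. comp_bounded d r b (C' j))" for y
      proof (cases "{x \<in> A. f x = y} = {}")
        case True
        then show ?thesis
          by (intro exI[of _ "\<lambda>_. {}"]) (simp add: comp_bounded_empty)
      next
        case False
        then obtain x0 where "x0 \<in> A" "f x0 = y" by blast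
        then have x0: "x0 \<in> carrier P" "f x0 = y" using AB by auto
        define C' where "C' j = {x \<in> carrier P. inv\<^bsub>P\<^esub> x0 \<otimes>\<^bsub>P\<^esub> x \<in> C j}" for j
        have "comp_bounded d r b (C' j)" if "j \<le> m" for j
        proof (rule comp_bounded_isometry[OF C(2)[OF that]])
          show "(\<lambda>x. inv\<^bsub>P\<^esub> x0 \<otimes>\<^bsub>P\<^esub> x) ` C' j \<subseteq> C j" by (auto simp: C'_def)
          show "d (inv\<^bsub>P\<^esub> x0 \<otimes>\<^bsub>P\<^esub> u) (inv\<^bsub>P\<^esub> x0 \<otimes>\<^bsub>P\<^esub> v) = d u v"
            if "u \<in> C' j" "v \<in> C' j" for u v
            using d that x0 by (simp add: proper_left_invariant_metric_def C'_def)
        qed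
        moreover have "{x \<in> A. f x = y} \<subseteq> (\<Union>j\<le>m. C' j)"
        proof
          fix x assume "x \<in> {x \<in> A. f x = y}"
          then have x: "x \<in> carrier P" "f x0 = f x" using AB x0 by auto
          have "inv\<^bsub>P\<^esub> x0 \<otimes>\<^bsub>P\<^esub> x \<in> K"
            using quasimorphism_fibre[OF P(1) Q(1) f x0(1) x] x x0 by (simp add: K_def D_def)
          then show "x \<in> (\<Union>j\<le>m. C' j)" using C(1) x unfolding C'_def by blast
        qed
        ultimately show ?thesis by blast
      qed
      then show "\<exists>b. \<forall>y\<in>B. \<exists>C'. {x \<in> A. f x = y} \<subseteq> (\<Union>j\<le>m. C' j) \<and>
        (\<forall>j\<le>m. comp_bounded d r b (C' j))" by blast
    qed
    then show ?thesis unfolding asdim_def by (auto intro: INF_lower)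
  qed
  have KP: "K \<subseteq> carrier P" by (simp add: K_def)
  have "asdim A d \<le> asdim B e + asdim K d"
  proof (cases "asdim B e" "asdim K d" rule: enat2_cases)
    case (enat_enat n m)
    then show ?thesis using main[OF asdim_le_attained asdim_le_attained] by simp
  qed auto
  then show ?thesis
    unfolding K_def[symmetric] group_asdim_eq[OF P(1) AB(1) d] group_asdim_eq[OF P(1) KP d]
      group_asdim_eq[OF Q(1) AB(2) e] .
qed

theorem theorem1p7:
  fixes G :: "('a, 'm) monoid_scheme" and H :: "('b, 'n) monoid_scheme"
    and \<Xi> :: "'a set" and \<Lambda> :: "'b set" and f :: "'a \<Rightarrow> 'b"
  defines "\<Xi>' \<equiv> enveloping_group G \<Xi>"
    and "\<Lambda>' \<equiv> enveloping_group H \<Lambda>"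
  defines "D \<equiv> defect_set \<Xi>' \<Lambda>' f"
  assumes "approximate_subgroup G \<Xi>" and "countable \<Xi>"
    and "approximate_subgroup H \<Lambda>" and "countable \<Lambda>"
    and "approx_quasimorphism G \<Xi> H \<Lambda> f"
  shows "group_asdim \<Xi>' \<Xi> \<le> group_asdim \<Lambda>' \<Lambda> +
    group_asdim \<Xi>'
      (f -` (f \<one>\<^bsub>\<Xi>'\<^esub> <#\<^bsub>\<Lambda>'\<^esub> (set_inv\<^bsub>\<Lambda>'\<^esub> D <#>\<^bsub>\<Lambda>'\<^esub> D)) \<inter> carrier \<Xi>')"
  unfolding D_def
proof (rule quasimorphism_asdim_le)
  show "group \<Xi>'" "group \<Lambda>'"
    using assms group_enveloping_group unfolding \<Xi>'_def \<Lambda>'_def by auto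
  show "countable (carrier \<Xi>')" "countable (carrier \<Lambda>')"
    using assms countable_enveloping_group unfolding \<Xi>'_def \<Lambda>'_def by auto
  show "\<Xi> \<subseteq> carrier \<Xi>'" "\<Lambda> \<subseteq> carrier \<Lambda>'"
    using assms subset_enveloping_group unfolding \<Xi>'_def \<Lambda>'_def by auto
  show "quasimorphism \<Xi>' \<Lambda>' f" "f ` \<Xi> \<subseteq> \<Lambda>"
    using assms unfolding \<Xi>'_def \<Lambda>'_def approx_quasimorphism_def by auto
qed

end
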